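(* Let $W:\mathbb{R}\to\mathbb{R}$ be a $1$-periodic even Lipschitz function with $\|W'\|_\infty=1$ and zero average over a period. Assume that $W'$ has a unique local maximum in $(0,1/2)$. Let $0<T<1$ and denote by $y_T\in(-1/2,0)$ the unique local minimiser of $y\mapsto Ty+W(y)$ in $[-1/2,1/2]$. Then for every fixed $\gamma>0$ one has $T<T_\gamma$ if and only if the function $$\varphi_T(y):=Ty+W(y)+\frac{\gamma}{2}(y-y_T)^2,\qquad y\in\mathbb{R},$$ has a unique global minimum, attained at $y_T$.
   Context: Pinning threshold: $T_\gamma:=\sup\{T: f_\gamma(T)=0\}$, where $f_\gamma$ is defined as follows. For $T\in\mathbb{R}$ and any $y_0\in\mathbb{R}$ let $y_0^T=y_0$ and, for $i\ge1$, let $y_i^T$ be a minimiser over $y\in\mathbb{R}$ of $Ty+W(y)+\frac{\gamma}{2}(y-y_{i-1}^T)^2$. Then $f_\gamma(T)=\lim_{i\to\infty}(y_0-y_i^T)/i$; this limit exists, does not depend on $y_0$, and $f_\gamma$ is nondecreasing in $T$. If minimisers are not unique they are chosen by a fixed selection $y_i^T=a_T(y_{i-1}^T)$ with $a_T(w+1)=a_T(w)+1$ for all $w\in\mathbb{R}$. *)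

theory Defs
  imports "HOL-Analysis.Analysis" "HOL-Probability.Essential_Supremum"
begin

definition local_minimum_on :: "real set \<Rightarrow> (real \<Rightarrow> real) \<Rightarrow> real \<Rightarrow> bool" where
  "local_minimum_on D g x \<longleftrightarrow> x \<in> D \<and> (\<forall>\<^sub>F y in at x within D. g x \<le> g y)"

definition local_maximum_on :: "real set \<Rightarrow> (real \<Rightarrow> real) \<Rightarrow> real \<Rightarrow> bool" where
  "local_maximum_on D g x \<longleftrightarrow> x \<in> D \<and> (\<forall>\<^sub>F y in at x within D. g y \<le> g x)"

text \<open>The domain of the derivative of a Lipschitz function: a set of full measure, outside which
  the value of the total function \<^const>\<open>deriv\<close> has no meaning.\<close>

definition diff_points :: "(real \<Rightarrow> real) \<Rightarrow> real set" where
  "diff_points W = {x. W differentiable (at x)}"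

text \<open>A fixed choice of minimisers of the incremental problem: \<open>a T w\<close> is the successor of \<open>w\<close>
  under the force \<open>T\<close>. Nothing but equivariance under integer translations is required of it.\<close>

definition minimiser_selection ::
    "(real \<Rightarrow> real) \<Rightarrow> real \<Rightarrow> (real \<Rightarrow> real \<Rightarrow> real) \<Rightarrow> bool" where
  "minimiser_selection W \<gamma> a \<longleftrightarrow>
     (\<forall>T w. is_arg_min (\<lambda>y. T * y + W y + \<gamma> / 2 * (y - w)\<^sup>2) (\<lambda>_. True) (a T w)) \<and>
     (\<forall>T w. a T (w + 1) = a T w + 1)"

definition discrete_orbit :: "(real \<Rightarrow> real \<Rightarrow> real) \<Rightarrow> real \<Rightarrow> real \<Rightarrow> nat \<Rightarrow> real" where
  "discrete_orbit a T y0 i = (a T ^^ i) y0"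

text \<open>\<open>mean_velocity a T\<close> is the paper's \<open>f\<^sub>\<gamma>(T)\<close>, for the parameter \<open>\<gamma>\<close> and the potential \<open>W\<close> of which
  \<open>a\<close> is a \<^const>\<open>minimiser_selection\<close>: the common limit for all initial points.\<close>

definition mean_velocity :: "(real \<Rightarrow> real \<Rightarrow> real) \<Rightarrow> real \<Rightarrow> real" where
  "mean_velocity a T =
     (THE v. \<forall>y0. (\<lambda>i. (y0 - discrete_orbit a T y0 i) / real i) \<longlonglongrightarrow> v)"

definition pinning_threshold :: "(real \<Rightarrow> real \<Rightarrow> real) \<Rightarrow> real" where
  "pinning_threshold a = Sup {T. mean_velocity a T = 0}"

end

theory Submission
  imports Defs
begin

text \<open>
  Call \<open>p\<close> a left barrier at force \<open>T\<close> if, among the competitors \<open>z < p\<close>, none beats \<open>p\<close> in the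
  incremental problem centred at \<open>p\<close>. At a force slightly smaller than \<open>T\<close>, an orbit that starts at
  such a \<open>p\<close> cannot move to the left of \<open>p\<close>, so that it is pinned. Conversely, if no \<open>p\<close> is a barrier
  at \<open>T'\<close>, then at every force \<open>T > T'\<close> each step of each orbit moves to the left by at least \<open>(T - T') / \<gamma>\<close>, and
  the mean velocity is positive. This rests on one computation, \<open>left_barrier_step\<close>: the minimiser
  chosen from \<open>w\<close> is itself a barrier, at the force \<open>T + \<gamma> (a T w - w)\<close>. Hence
  \<open>less_pinning_threshold_iff\<close>: for \<open>T \<ge> 0\<close>, \<open>T\<close> lies below the threshold exactly when a barrier exists
  at some force larger than \<open>T\<close>. The mean velocity is a translation number of a monotone map of degree
  one, which gives its existence and its independence of the starting point.

  It remains to compare barriers with \<open>yT\<close>. Write \<open>G y = T y + W y\<close>. Its local minimisers are the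
  integer translates of \<open>yT\<close>, so \<open>G\<close> first increases and then decreases between two consecutive ones.

  Suppose that \<open>p\<close> is a barrier at \<open>T' > T\<close>, translated into \<open>(yT - 1, yT]\<close>. If \<open>G p < G yT\<close>, then \<open>p\<close> lies
  where \<open>G\<close> increases; the additional force \<open>T' - T\<close> makes the energy drop to the left of \<open>p\<close> linearly,
  which beats the quadratic penalty: no barrier. So \<open>G yT \<le> G p\<close>. Then competitors of \<open>yT\<close> in \<open>[p, yT)\<close>
  have no smaller \<open>G\<close>, and those to the left of \<open>p\<close> are excluded by the barrier, since they are even
  farther from \<open>yT\<close> than from \<open>p\<close>. Thus \<open>yT\<close> is the unique global minimiser
  (\<open>barrier_imp_strict_minimum\<close>).

  Suppose conversely that \<open>yT\<close> is the unique global minimiser. If some \<open>w\<close> satisfies \<open>w < a T w\<close>, then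
  \<open>left_barrier_step\<close> yields a barrier at a force larger than \<open>T\<close>. Otherwise no step goes to the right. By
  uniqueness the successors of points slightly to the left of \<open>yT\<close> stay close to \<open>yT\<close>, where \<open>G\<close> is
  strictly decreasing; moving to the left would cost energy, so these points are fixed. But \<open>G\<close> varies
  at most quadratically between fixed points, hence is constant on an interval of them, a contradiction
  (\<open>strict_minimum_imp_advance\<close>).
\<close>

section \<open>Translation numbers of monotone maps of degree one\<close>

lemma funpow_degree_one:
  fixes F :: "real \<Rightarrow> real"
  assumes deg: "\<And>x. F (x + 1) = F x + 1"
  shows "(F ^^ n) (x + of_int k) = (F ^^ n) x + of_int k"
proof -
  have nat_shift: "F (x + real m) = F x + real m" for x m
  proof (induction m)
    case (Suc m)
    have "F (x + real (Suc m)) = F ((x + real m) + 1)" by (simp add: algebra_simps)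
    also have "\<dots> = F x + real (Suc m)" using Suc deg by simp
    finally show ?case .
  qed simp
  have int_shift: "F (x + of_int k) = F x + of_int k" for x k
  proof (cases "k \<ge> 0")
    case True
    then show ?thesis using nat_shift[of x "nat k"] by simp
  next
    case False
    then show ?thesis using nat_shift[of "x + of_int k" "nat (- k)"] by simp
  qed
  show ?thesis by (induction n) (simp_all add: int_shift)
qed

text \<open>The displacement of the \<open>n\<close>-th iterate varies by at most one over the starting points. The displacements
\<open>c n\<close> from \<open>0\<close> are therefore additive in \<open>n\<close> up to an error of one, and comparing \<open>c (m * n)\<close> with both
\<open>m * c n\<close> and \<open>n * c m\<close> shows that \<open>c n / n\<close> is a Cauchy sequence.\<close>

lemma translation_number_exists:
  fixes F :: "real \<Rightarrow> real"
  assumes mono: "mono F" and deg: "\<And>x. F (x + 1) = F x + 1"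
  shows "\<exists>v. \<forall>x. (\<lambda>n. (x - (F ^^ n) x) / real n) \<longlonglongrightarrow> v"
proof -
  define c where "c n = (F ^^ n) 0" for n
  have displacement: "\<bar>(F ^^ n) x - x - c n\<bar> \<le> 1" for n x
  proof -
    have mn: "mono (F ^^ n)" using mono by (rule mono_pow)
    have "(F ^^ n) (0 + of_int \<lfloor>x\<rfloor>) \<le> (F ^^ n) x"
      and "(F ^^ n) x \<le> (F ^^ n) (0 + of_int (\<lfloor>x\<rfloor> + 1))"
      using mn by (auto intro!: monoD[OF mn])
    then have "c n + of_int \<lfloor>x\<rfloor> \<le> (F ^^ n) x" "(F ^^ n) x \<le> c n + of_int (\<lfloor>x\<rfloor> + 1)"
      unfolding funpow_degree_one[of F, OF deg] c_def by auto
    then show ?thesis by linarith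
  qed
  have additive: "\<bar>c (m + n) - c m - c n\<bar> \<le> 1" for m n
    using displacement[of m "c n"] by (simp add: c_def funpow_add)
  have multiple: "\<bar>c (m * n) - real m * c n\<bar> \<le> real m" for m n
  proof (induction m)
    case (Suc m)
    then show ?case using additive[of n "m * n"] by (simp add: algebra_simps)
  qed (simp add: c_def)
  have close: "\<bar>- c n / real n - - c m / real m\<bar> \<le> 1 / real n + 1 / real m"
    if "n > 0" "m > 0" for m n
  proof -
    have "\<bar>real n * c m - real m * c n\<bar> \<le> real m + real n"
      using multiple[of m n] multiple[of n m] by (simp add: mult.commute)
    moreover have "- c n / real n - - c m / real m = (real n * c m - real m * c n) / (real m * real n)"
      using that by (simp add: field_simps)
    moreover have "1 / real n + 1 / real m = (real m + real n) / (real m * real n)"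
      using that by (simp add: field_simps)
    ultimately show ?thesis using that by (simp add: abs_divide abs_mult divide_right_mono)
  qed
  have "Cauchy (\<lambda>n. - c n / real n)"
  proof (rule CauchyI)
    fix e :: real assume "e > 0"
    then obtain M where M: "M > 0" "inverse (real M) < e / 2"
      by (metis half_gt_zero reals_Archimedean zero_less_Suc)
    show "\<exists>M. \<forall>m\<ge>M. \<forall>n\<ge>M. norm (- c m / real m - - c n / real n) < e"
    proof (intro exI allI impI)
      fix m n assume mn: "m \<ge> M" "n \<ge> M"
      then have "1 / real m \<le> inverse (real M)" "1 / real n \<le> inverse (real M)"
        using M by (auto simp: inverse_eq_divide intro!: divide_left_mono)
      then show "norm (- c m / real m - - c n / real n) < e"
        using close[of m n] mn M by simp
    qed
  qed
  then obtain v where v: "(\<lambda>n. - c n / real n) \<longlonglongrightarrow> v"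
    using Cauchy_convergent convergent_def by blast
  have "(\<lambda>n. (x - (F ^^ n) x) / real n) \<longlonglongrightarrow> v" for x
  proof -
    have "(\<lambda>n. ((F ^^ n) x - x - c n) / real n) \<longlonglongrightarrow> 0"
    proof (rule Lim_null_comparison)
      show "\<forall>\<^sub>F n in sequentially. norm (((F ^^ n) x - x - c n) / real n) \<le> 1 / real n"
        using displacement by (intro always_eventually) (auto simp: divide_right_mono)
    qed (rule lim_1_over_n)
    from tendsto_diff[OF v this]
    show ?thesis by (simp add: diff_divide_distrib add_divide_distrib)
  qed
  then show ?thesis by blast
qed

section \<open>The incremental minimisation map\<close>

lemma minimiser_selectionD:
  assumes "minimiser_selection W \<gamma> a"
  shows "T * a T w + W (a T w) + \<gamma> / 2 * (a T w - w)\<^sup>2 \<le> T * z + W z + \<gamma> / 2 * (z - w)\<^sup>2"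
    and "a T (w + 1) = a T w + 1"
  using assms unfolding minimiser_selection_def is_arg_min_def by (auto simp: not_less)

text \<open>Add the minimality of \<open>a T w\<close> tested against \<open>a T w'\<close> to that of \<open>a T w'\<close> tested against \<open>a T w\<close>: only
the cross terms of the squares survive, and they give \<open>0 \<le> (w' - w) * (a T w' - a T w)\<close>.\<close>

lemma minimiser_selection_mono:
  assumes "\<gamma> > 0" and sel: "minimiser_selection W \<gamma> a"
  shows "mono (a T)"
proof (rule monoI)
  fix w w' :: real assume "w \<le> w'"
  show "a T w \<le> a T w'"
  proof (cases "w = w'")
    case False
    then have "w < w'" using \<open>w \<le> w'\<close> by simp
    have "0 \<le> \<gamma> * ((w' - w) * (a T w' - a T w))"
      using minimiser_selectionD(1)[OF sel, of T w "a T w'"]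
        minimiser_selectionD(1)[OF sel, of T w' "a T w"]
      by (simp add: power2_eq_square algebra_simps)
    then show ?thesis using \<open>\<gamma> > 0\<close> \<open>w < w'\<close> by (simp add: zero_le_mult_iff)
  qed simp
qed

lemma mean_velocity_tendsto:
  assumes "\<gamma> > 0" and sel: "minimiser_selection W \<gamma> a"
  shows "(\<lambda>i. (x - discrete_orbit a T x i) / real i) \<longlonglongrightarrow> mean_velocity a T"
proof -
  obtain v where v: "\<forall>y0. (\<lambda>i. (y0 - discrete_orbit a T y0 i) / real i) \<longlonglongrightarrow> v"
    using translation_number_exists[OF minimiser_selection_mono[OF assms]]
      minimiser_selectionD(2)[OF sel] unfolding discrete_orbit_def by blast
  moreover have "mean_velocity a T = v"
    unfolding mean_velocity_def using v by (blast intro: LIMSEQ_unique)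
  ultimately show ?thesis by blast
qed

lemma mean_velocity_nonpos:
  assumes "\<gamma> > 0" "minimiser_selection W \<gamma> a" and "p \<le> a T p"
  shows "mean_velocity a T \<le> 0"
proof -
  have "p \<le> discrete_orbit a T p i" for i
    unfolding discrete_orbit_def
  proof (induction i)
    case (Suc i)
    then show ?case
      using monoD[OF minimiser_selection_mono[OF assms(1,2), where T = T] Suc] assms(3) by simp
  qed simp
  then show ?thesis
    by (intro LIMSEQ_le_const2[OF mean_velocity_tendsto[OF assms(1,2), where x = p]])
       (auto intro!: divide_nonpos_nonneg)
qed

lemma mean_velocity_nonneg:
  assumes "\<gamma> > 0" "minimiser_selection W \<gamma> a" and "a T p \<le> p"
  shows "0 \<le> mean_velocity a T"
proof -
  have "discrete_orbit a T p i \<le> p" for i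
    unfolding discrete_orbit_def
  proof (induction i)
    case (Suc i)
    then show ?case
      using monoD[OF minimiser_selection_mono[OF assms(1,2), where T = T] Suc] assms(3) by simp
  qed simp
  then show ?thesis
    by (intro LIMSEQ_le_const[OF mean_velocity_tendsto[OF assms(1,2), where x = p]])
       (auto intro!: divide_nonneg_nonneg)
qed

lemma mean_velocity_ge:
  assumes "\<gamma> > 0" "minimiser_selection W \<gamma> a" and step: "\<And>w. a T w \<le> w - e"
  shows "e \<le> mean_velocity a T"
proof -
  have "discrete_orbit a T 0 i \<le> - (real i * e)" for i
    unfolding discrete_orbit_def
  proof (induction i)
    case (Suc i)
    then show ?case using step[of "(a T ^^ i) 0"] by (simp add: algebra_simps)
  qed simp
  then have "e \<le> (0 - discrete_orbit a T 0 i) / real i" if "i \<ge> 1" for i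
    using that by (simp add: field_simps) (metis add.inverse_inverse mult.commute neg_le_iff_le)
  then show ?thesis
    by (intro LIMSEQ_le_const[OF mean_velocity_tendsto[OF assms(1,2), where x = 0]]) blast
qed

section \<open>Barriers and the pinning threshold\<close>

text \<open>Only competitors to the left count: for \<open>T \<ge> 0\<close> orbits drift to the left, and restricting the
competitors is what makes the notion antitone in \<open>T\<close>.\<close>

definition left_barrier :: "(real \<Rightarrow> real) \<Rightarrow> real \<Rightarrow> real \<Rightarrow> real \<Rightarrow> bool" where
  "left_barrier W \<gamma> T p \<longleftrightarrow> (\<forall>z<p. T * p + W p \<le> T * z + W z + \<gamma> / 2 * (z - p)\<^sup>2)"

lemma left_barrierD:
  "left_barrier W \<gamma> T p \<Longrightarrow> z < p \<Longrightarrow> T * (p - z) + W p - W z \<le> \<gamma> / 2 * (p - z)\<^sup>2"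
  unfolding left_barrier_def by (auto simp: algebra_simps power2_commute)

lemma left_barrier_antimono:
  assumes "left_barrier W \<gamma> T p" "T' \<le> T"
  shows "left_barrier W \<gamma> T' p"
  unfolding left_barrier_def
proof (intro allI impI)
  fix z assume "z < p"
  then have "T' * (p - z) \<le> T * (p - z)" using assms(2) by (intro mult_right_mono) auto
  then show "T' * p + W p \<le> T' * z + W z + \<gamma> / 2 * (z - p)\<^sup>2"
    using left_barrierD[OF assms(1) \<open>z < p\<close>] by (simp add: algebra_simps power2_commute)
qed

lemma left_barrier_translate:
  assumes per: "\<And>x k. W (x + of_int k) = W x" and "left_barrier W \<gamma> T p"
  shows "left_barrier W \<gamma> T (p + of_int k)"
  unfolding left_barrier_def
proof (intro allI impI)
  fix z assume "z < p + of_int k"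
  then have "z - of_int k < p" by simp
  from left_barrierD[OF assms(2) this]
  show "T * (p + of_int k) + W (p + of_int k) \<le> T * z + W z + \<gamma> / 2 * (z - (p + of_int k))\<^sup>2"
    using per[of "z - of_int k" k] by (simp add: per algebra_simps power2_eq_square)
qed

text \<open>The minimality of \<open>a T w\<close> involves squared distances to \<open>w\<close>. Recentring the square at \<open>a T w\<close> produces a
linear term, which acts as the additional force \<open>\<gamma> * (a T w - w)\<close>: positive when the orbit steps to the
right, and small in absolute value when the step is short.\<close>

lemma left_barrier_step:
  assumes sel: "minimiser_selection W \<gamma> a"
  shows "left_barrier W \<gamma> (T + \<gamma> * (a T w - w)) (a T w)"
  unfolding left_barrier_def
proof (intro allI impI)
  fix z assume "z < a T w"
  show "(T + \<gamma> * (a T w - w)) * a T w + W (a T w)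
      \<le> (T + \<gamma> * (a T w - w)) * z + W z + \<gamma> / 2 * (z - a T w)\<^sup>2"
    using minimiser_selectionD(1)[OF sel, of T w z]
    by (simp add: power2_eq_square algebra_simps)
qed

text \<open>To the left of a barrier the energy may fall at most quadratically, so the force cannot exceed a bound
for the slope of the potential there. This bounds the force at every barrier by the Lipschitz constant of
\<open>W\<close>, and it rules out barriers where the tilted potential increases.\<close>

lemma left_barrier_le_slope:
  assumes bar: "left_barrier W \<gamma> T p" and "q < p"
    and slope: "\<And>z. q < z \<Longrightarrow> z < p \<Longrightarrow> W z - W p \<le> S * (p - z)"
  shows "T \<le> S"
proof -
  have "T - S \<le> \<gamma> / 2 * (p - z)" if z: "q < z" "z < p" for z
  proof -
    have "(T - S) * (p - z) \<le> (\<gamma> / 2 * (p - z)) * (p - z)"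
      using left_barrierD[OF bar z(2)] slope[OF z] by (simp add: power2_eq_square algebra_simps)
    then show ?thesis using z by (simp add: mult_le_cancel_right)
  qed
  then have "\<forall>\<^sub>F z in at_left p. T - S \<le> \<gamma> / 2 * (p - z)"
    using \<open>q < p\<close> by (auto simp: eventually_at_left)
  moreover have "((\<lambda>z. \<gamma> / 2 * (p - z)) \<longlongrightarrow> \<gamma> / 2 * (p - p)) (at_left p)"
    by (intro tendsto_intros)
  ultimately have "T - S \<le> \<gamma> / 2 * (p - p)"
    by (intro tendsto_lowerbound) auto
  then show ?thesis by simp
qed

lemma periodic_int:
  fixes W :: "real \<Rightarrow> real"
  assumes per: "\<And>x. W (x + 1) = W x"
  shows "W (x + of_int k) = W x"
proof -
  have n: "W (x + real n) = W x" for x n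
    by (induction n) (simp_all add: per add.assoc[symmetric] add.commute[of 1])
  show ?thesis
  proof (cases "k \<ge> 0")
    case True
    then show ?thesis using n[of x "nat k"] by simp
  next
    case False
    then show ?thesis using n[of "x + of_int k" "nat (- k)"] by simp
  qed
qed

lemma continuous_periodic_attains_inf:
  fixes W :: "real \<Rightarrow> real"
  assumes per: "\<And>x. W (x + 1) = W x" and cont: "continuous_on UNIV W"
  obtains m where "\<And>y. W m \<le> W y"
proof -
  have "continuous_on {0..1} W" using cont continuous_on_subset by blast
  then obtain m where m: "\<And>y. y \<in> {0..1} \<Longrightarrow> W m \<le> W y"
    using continuous_attains_inf[of "{0..1::real}" W] by force
  have "W m \<le> W y" for y
    using m[of "y + of_int (- \<lfloor>y\<rfloor>)"] periodic_int[of W y "- \<lfloor>y\<rfloor>", OF per]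
    by auto linarith
  then show thesis using that by blast
qed

text \<open>Besides the two implications between barriers and vanishing velocity, the supremum requires that the set
of pinned forces is nonempty and bounded above. A global minimiser \<open>m\<close> of \<open>W\<close> is fixed at force \<open>0\<close>; it
also stops orbits from moving to the right at every force \<open>S \<ge> 0\<close>, so that velocities are nonnegative.\<close>

lemma less_pinning_threshold_iff:
  assumes per: "\<And>x. W (x + 1) = W x" and lip: "L-lipschitz_on UNIV W"
    and "\<gamma> > 0" and sel: "minimiser_selection W \<gamma> a" and "0 \<le> T"
  shows "T < pinning_threshold a \<longleftrightarrow> (\<exists>T'>T. \<exists>p. left_barrier W \<gamma> T' p)"
proof -
  let ?P = "{T. mean_velocity a T = 0}"
  obtain m where m: "\<And>y. W m \<le> W y"
    using continuous_periodic_attains_inf[OF per lipschitz_on_continuous_on[OF lip]] by blast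
  have below: "a S m \<le> m" if "S \<ge> 0" for S
  proof (rule ccontr)
    assume "\<not> a S m \<le> m"
    then have "S * m \<le> S * a S m" "0 < \<gamma> / 2 * (a S m - m)\<^sup>2"
      using that \<open>\<gamma> > 0\<close> by (auto intro: mult_left_mono)
    then show False
      using minimiser_selectionD(1)[OF sel, of S m m] m[of "a S m"] by simp
  qed
  have zero: "0 \<in> ?P"
  proof -
    have "\<gamma> / 2 * (a 0 m - m)\<^sup>2 \<le> 0"
      using minimiser_selectionD(1)[OF sel, of 0 m m] m[of "a 0 m"] by simp
    then have "(a 0 m - m)\<^sup>2 \<le> 0" using \<open>\<gamma> > 0\<close> by (simp add: mult_le_0_iff)
    then have "a 0 m = m" by simp
    then show ?thesis
      using mean_velocity_nonneg[OF \<open>\<gamma> > 0\<close> sel, of 0 m]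
        mean_velocity_nonpos[OF \<open>\<gamma> > 0\<close> sel, of m 0] by simp
  qed
  \<comment> \<open>A positive velocity would result if all steps had length at least \<open>e\<close>; a shorter step costs at most
    \<open>\<gamma> * e = S' - S\<close> in force when its end point is turned into a barrier.\<close>
  have barrier: "\<exists>p. left_barrier W \<gamma> S p" if "mean_velocity a S' = 0" "S < S'" for S S'
  proof -
    define e where "e = (S' - S) / \<gamma>"
    have "e > 0" unfolding e_def using that \<open>\<gamma> > 0\<close> by simp
    have "\<exists>w. w - e < a S' w"
    proof (rule ccontr)
      assume "\<not> ?thesis"
      then have "e \<le> mean_velocity a S'"
        by (intro mean_velocity_ge[OF \<open>\<gamma> > 0\<close> sel]) (simp add: not_less)
      then show False using \<open>e > 0\<close> that(1) by simp
    qed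
    then obtain w where w: "w - e < a S' w" by blast
    have "\<gamma> * (- e) \<le> \<gamma> * (a S' w - w)" using w \<open>\<gamma> > 0\<close> by (intro mult_left_mono) auto
    then have "S \<le> S' + \<gamma> * (a S' w - w)" using \<open>\<gamma> > 0\<close> by (simp add: e_def)
    then show ?thesis using left_barrier_step[OF sel] left_barrier_antimono by blast
  qed
  have barrier_le: "S \<le> L" if bar: "left_barrier W \<gamma> S p" for S p
  proof (rule left_barrier_le_slope[OF bar])
    show "p - 1 < p" by simp
    fix z assume "z < p"
    then show "W z - W p \<le> L * (p - z)"
      using lipschitz_onD[OF lip, of z p] by (auto simp: dist_real_def)
  qed
  have "bdd_above ?P"
  proof (rule bdd_aboveI, rule ccontr)
    fix S assume S: "S \<in> ?P" "\<not> S \<le> L"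
    then obtain S1 where "L < S1" "S1 < S" using dense not_le by blast
    then show False using barrier[of S S1] S barrier_le by force
  qed
  have pinned: "mean_velocity a S = 0" if bar: "left_barrier W \<gamma> S' p" and S: "0 \<le> S" "S < S'" for S S' p
  proof -
    have "p \<le> a S p"
    proof (rule ccontr)
      assume "\<not> p \<le> a S p"
      then have less: "a S p < p" by simp
      \<comment> \<open>A barrier at \<open>S'\<close> may tie with a competitor; lowering the force to \<open>S\<close> makes it strictly better.\<close>
      then have "S * (p - a S p) < S' * (p - a S p)" using S by simp
      then show False
        using left_barrierD[OF bar less] minimiser_selectionD(1)[OF sel, of S p p]
        by (simp add: power2_commute algebra_simps)
    qed
    then show ?thesis
      using mean_velocity_nonpos[OF \<open>\<gamma> > 0\<close> sel] mean_velocity_nonneg[OF \<open>\<gamma> > 0\<close> sel below[OF S(1)]]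
      by (meson antisym)
  qed
  show ?thesis
  proof
    assume "T < pinning_threshold a"
    then obtain S where "mean_velocity a S = 0" "T < S"
      using less_cSup_iff[OF _ \<open>bdd_above ?P\<close>] zero unfolding pinning_threshold_def by blast
    then show "\<exists>T'>T. \<exists>p. left_barrier W \<gamma> T' p"
      using barrier dense by meson
  next
    assume "\<exists>T'>T. \<exists>p. left_barrier W \<gamma> T' p"
    then obtain T' p where T': "T < T'" "left_barrier W \<gamma> T' p" by blast
    then obtain S where S: "T < S" "S < T'" using dense by blast
    then have "S \<in> ?P" using pinned[OF T'(2)] \<open>0 \<le> T\<close> by simp
    then have "S \<le> pinning_threshold a"
      unfolding pinning_threshold_def using \<open>bdd_above ?P\<close> by (rule cSup_upper)
    then show "T < pinning_threshold a" using S by simp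
  qed
qed

section \<open>The shape of the tilted potential\<close>

text \<open>Otherwise the minimum of \<open>g\<close> over \<open>[u, v]\<close> would be attained at an interior point, which would be a local
minimiser. This strict quasiconcavity stands in for a derivative that changes sign only once.\<close>

lemma no_local_minimum_imp_gt_min:
  fixes g :: "real \<Rightarrow> real"
  assumes cont: "continuous_on {u..v} g"
    and none: "\<And>x. u < x \<Longrightarrow> x < v \<Longrightarrow> \<not> local_minimum_on UNIV g x"
    and x: "u < x" "x < v"
  shows "min (g u) (g v) < g x"
proof (rule ccontr)
  assume le: "\<not> min (g u) (g v) < g x"
  obtain m where m: "m \<in> {u..v}" "\<And>y. y \<in> {u..v} \<Longrightarrow> g m \<le> g y"
    using continuous_attains_inf[of "{u..v}" g] cont x by auto
  have "\<exists>n. u < n \<and> n < v \<and> (\<forall>y\<in>{u..v}. g n \<le> g y)"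
  proof (cases "m = u \<or> m = v")
    case True
    then have "g x \<le> g m" using le by auto
    then show ?thesis using m x by (intro exI[of _ x]) (auto intro: order_trans)
  next
    case False
    then show ?thesis using m by (intro exI[of _ m]) auto
  qed
  then obtain n where n: "u < n" "n < v" "\<forall>y\<in>{u..v}. g n \<le> g y" by blast
  then have "\<forall>\<^sub>F y in at n. y \<in> {u<..<v}"
    by (intro eventually_at_in_open') auto
  then have "\<forall>\<^sub>F y in at n. g n \<le> g y"
    by eventually_elim (use n in auto)
  then show False using none[OF n(1,2)] by (simp add: local_minimum_on_def)
qed

text \<open>By periodicity it is the same to have only one local minimiser in a period as to have only the integer
translates of \<open>yT\<close>; the second form avoids the end points of the period.\<close>

locale tilted_potential =
  fixes W :: "real \<Rightarrow> real" and T yT :: real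
  assumes periodic: "\<And>x. W (x + 1) = W x"
    and cont: "continuous_on UNIV W"
    and T_pos: "0 < T"
    and yT_min: "local_minimum_on UNIV (\<lambda>y. T * y + W y) yT"
    and yT_unique: "\<And>y. local_minimum_on UNIV (\<lambda>y. T * y + W y) y \<Longrightarrow> \<exists>k. y = yT + of_int k"
begin

definition tilted :: "real \<Rightarrow> real" where "tilted y = T * y + W y"

lemma tilted_shift: "tilted (y + of_int k) = tilted y + T * of_int k"
  unfolding tilted_def using periodic_int[of W, OF periodic] by (simp add: algebra_simps)

lemma tilted_cont: "continuous_on S tilted"
  unfolding tilted_def using cont continuous_on_subset by (intro continuous_intros) auto

lemma tilted_gt_min:
  assumes "yT - 1 \<le> u" "u < x" "x < v" "v \<le> yT"
  shows "min (tilted u) (tilted v) < tilted x"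
proof (rule no_local_minimum_imp_gt_min[OF tilted_cont _ assms(2,3)])
  fix y assume y: "u < y" "y < v"
  show "\<not> local_minimum_on UNIV tilted y"
  proof
    assume "local_minimum_on UNIV tilted y"
    then obtain k :: int where "y = yT + of_int k"
      using yT_unique unfolding tilted_def[abs_def] by blast
    then have "- 1 < k" "k < 0" using y assms by auto
    then show False by simp
  qed
qed

lemma tilted_minimal_to_right: "yT \<le> y \<Longrightarrow> tilted yT \<le> tilted y"
proof -
  assume y: "yT \<le> y"
  define k where "k = \<lfloor>y - yT\<rfloor>"
  have k: "0 \<le> k" "of_int k \<le> y - yT" "y - yT < of_int k + 1"
    using y unfolding k_def by linarith+
  define x where "x = y - of_int (k + 1)"
  have x: "yT - 1 \<le> x" "x < yT" using k unfolding x_def by auto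
  have left: "tilted (yT - 1) = tilted yT - T" using tilted_shift[of "yT" "-1"] by simp
  have "tilted (yT - 1) \<le> tilted x"
    using tilted_gt_min[of "yT - 1" x yT] x T_pos left by (cases "x = yT - 1") auto
  moreover have "tilted y = tilted x + T * (of_int k + 1)"
    using tilted_shift[of x "k + 1"] by (simp add: x_def)
  moreover have "0 \<le> T * of_int k" using k T_pos by simp
  ultimately show ?thesis using left by (simp add: algebra_simps)
qed

text \<open>Take for \<open>q\<close> a maximiser over the period that ends at \<open>yT\<close>: with a maximal value at \<open>q\<close>, quasiconcavity
on \<open>[q, w]\<close> forces every point between to lie above \<open>w\<close>. It differs from \<open>yT\<close> because the local minimum at
\<open>yT\<close> is strict from the left.\<close>

lemma tilted_decreasing_before_minimum:
  obtains q where "q < yT" and "\<And>y w. q \<le> y \<Longrightarrow> y < w \<Longrightarrow> w \<le> yT \<Longrightarrow> tilted w < tilted y"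
proof -
  obtain q where q: "q \<in> {yT - 1..yT}" "\<And>y. y \<in> {yT - 1..yT} \<Longrightarrow> tilted y \<le> tilted q"
    using continuous_attains_sup[of "{yT - 1..yT}" tilted] tilted_cont by auto
  have "\<forall>\<^sub>F y in at_left yT. tilted yT \<le> tilted y"
    using yT_min unfolding local_minimum_on_def tilted_def at_eq_sup_left_right eventually_sup by blast
  then obtain b where b: "b < yT" "\<And>y. b < y \<Longrightarrow> y < yT \<Longrightarrow> tilted yT \<le> tilted y"
    unfolding eventually_at_left_field by auto
  define u where "u = max ((b + yT) / 2) (yT - 1)"
  define v where "v = (u + yT) / 2"
  have uv: "b < u" "yT - 1 \<le> u" "u < v" "v < yT"
    using b(1) unfolding u_def v_def by (auto simp: max_def)
  have "tilted yT < tilted v" using tilted_gt_min[of u v yT] b(2)[of u] uv by auto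
  then have "q < yT" using q(1) q(2)[of v] uv by (cases "q = yT") auto
  moreover have "tilted w < tilted y" if "q \<le> y" "y < w" "w \<le> yT" for y w
  proof -
    have "tilted w < tilted y" if "q < y" using tilted_gt_min[of q y w] q(1) q(2)[of w] that \<open>y < w\<close> \<open>w \<le> yT\<close> by auto
    moreover have "tilted w < tilted q" if "q < w"
    proof -
      define x where "x = (q + w) / 2"
      have x: "q < x" "x < w" using that unfolding x_def by auto
      have "tilted w < tilted x" using tilted_gt_min[of q x w] q(1) q(2)[of w] x \<open>w \<le> yT\<close> by auto
      then show ?thesis using q(2)[of x] q(1) x \<open>w \<le> yT\<close> by auto
    qed
    ultimately show ?thesis using that by (cases "q = y") auto
  qed
  ultimately show thesis using that by blast
qed

text \<open>The barrier is first moved by an integer to a point \<open>r\<close> in \<open>(yT - 1, yT]\<close>. If \<open>r\<close> were lower than \<open>yT\<close>, it would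
lie on the increasing branch, where the slope bound forces \<open>T' \<le> T\<close>. Hence \<open>r\<close> is at least as high as
\<open>yT\<close>, and the barrier at \<open>r\<close> screens \<open>yT\<close> from everything to the left of \<open>r\<close>.\<close>

lemma barrier_imp_strict_minimum:
  assumes "\<gamma> > 0" "T < T'" and bar: "left_barrier W \<gamma> T' p" and "y \<noteq> yT"
  shows "tilted yT < tilted y + \<gamma> / 2 * (y - yT)\<^sup>2"
proof -
  have quad: "0 < \<gamma> / 2 * (y - yT)\<^sup>2" using \<open>\<gamma> > 0\<close> \<open>y \<noteq> yT\<close> by simp
  define r where "r = p + of_int (- \<lceil>p - yT\<rceil>)"
  have r: "yT - 1 < r" "r \<le> yT" unfolding r_def by (simp_all, linarith+)
  have bar_r: "left_barrier W \<gamma> T' r"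
    unfolding r_def by (intro left_barrier_translate[OF periodic_int] periodic bar)
  have top: "tilted yT \<le> tilted r"
  proof (rule ccontr)
    assume low: "\<not> tilted yT \<le> tilted r"
    then have "r < yT" using r by (cases "r = yT") auto
    have "tilted z < tilted r" if "yT - 1 < z" "z < r" for z
      using tilted_gt_min[of z r yT] that low \<open>r < yT\<close> by auto
    then have "W z - W r \<le> T * (r - z)" if "yT - 1 < z" "z < r" for z
      using that unfolding tilted_def by (force simp: algebra_simps)
    then have "T' \<le> T" using left_barrier_le_slope[OF bar_r r(1)] by blast
    then show False using \<open>T < T'\<close> by simp
  qed
  consider "yT \<le> y" | "r \<le> y" "y < yT" | "y < r" by linarith
  then show ?thesis
  proof cases
    case 1
    then show ?thesis using tilted_minimal_to_right quad by force
  next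
    case 2
    then have "tilted yT \<le> tilted y"
      using tilted_gt_min[of r y yT] r top by (cases "y = r") auto
    then show ?thesis using quad by simp
  next
    case 3
    have "T * (r - y) < T' * (r - y)" using 3 \<open>T < T'\<close> by simp
    then have "tilted r < tilted y + \<gamma> / 2 * (r - y)\<^sup>2"
      using left_barrierD[OF bar_r 3] unfolding tilted_def by (simp add: algebra_simps)
    moreover have "\<gamma> / 2 * (r - y)\<^sup>2 \<le> \<gamma> / 2 * (yT - y)\<^sup>2"
      using 3 r \<open>\<gamma> > 0\<close> by (intro mult_left_mono power_mono) auto
    ultimately show ?thesis using top by (simp add: power2_commute)
  qed
qed

text \<open>If all steps went weakly to the left, the points just to the left of \<open>yT\<close> would be fixed, as their
successors accumulate only at the unique minimiser \<open>yT\<close> and the tilted potential decreases there. On an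
interval of fixed points it has zero derivative, which contradicts strict monotonicity.\<close>

lemma strict_minimum_imp_advance:
  assumes "\<gamma> > 0" and sel: "minimiser_selection W \<gamma> a"
    and strict: "\<And>y. y \<noteq> yT \<Longrightarrow> tilted yT < tilted y + \<gamma> / 2 * (y - yT)\<^sup>2"
  shows "\<exists>w. w < a T w"
proof (rule ccontr)
  assume "\<not> (\<exists>w. w < a T w)"
  then have retreat: "a T w \<le> w" for w by (simp add: not_less)
  have min: "tilted (a T w) + \<gamma> / 2 * (a T w - w)\<^sup>2 \<le> tilted z + \<gamma> / 2 * (z - w)\<^sup>2" for w z
    using minimiser_selectionD(1)[OF sel, of T w z] unfolding tilted_def .
  obtain q where q: "q < yT" "\<And>y w. q \<le> y \<Longrightarrow> y < w \<Longrightarrow> w \<le> yT \<Longrightarrow> tilted w < tilted y"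
    using tilted_decreasing_before_minimum by blast
  define w where "w n = yT - inverse (real (Suc n))" for n
  have w_lim: "w \<longlonglongrightarrow> yT"
    unfolding w_def using tendsto_diff[OF tendsto_const LIMSEQ_inverse_real_of_nat, of yT] by simp
  have "incseq (\<lambda>n. a T (w n))"
    unfolding incseq_def w_def
    by (auto intro!: monoD[OF minimiser_selection_mono[OF \<open>\<gamma> > 0\<close> sel]] le_imp_inverse_le)
  moreover have "a T (w n) \<le> yT" for n
    using retreat[of "w n"] by (simp add: w_def) (smt (verit) inverse_nonnegative_iff_nonnegative of_nat_0_le_iff)
  ultimately obtain l where l: "(\<lambda>n. a T (w n)) \<longlonglongrightarrow> l"
    using incseq_convergent[of "\<lambda>n. a T (w n)" yT] by blast
  \<comment> \<open>Minimality passes to the limit, so \<open>l\<close> minimises the problem centred at \<open>yT\<close>.\<close>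
  have "tilted l + \<gamma> / 2 * (l - yT)\<^sup>2 \<le> tilted yT + \<gamma> / 2 * (yT - yT)\<^sup>2"
  proof (rule LIMSEQ_le)
    show "(\<lambda>n. tilted (a T (w n)) + \<gamma> / 2 * (a T (w n) - w n)\<^sup>2) \<longlonglongrightarrow> tilted l + \<gamma> / 2 * (l - yT)\<^sup>2"
      using continuous_on_tendsto_compose[OF tilted_cont[of UNIV] l]
      by (intro tendsto_intros l w_lim) auto
    show "(\<lambda>n. tilted yT + \<gamma> / 2 * (yT - w n)\<^sup>2) \<longlonglongrightarrow> tilted yT + \<gamma> / 2 * (yT - yT)\<^sup>2"
      by (intro tendsto_intros w_lim)
  qed (use min in auto)
  then have "l = yT" using strict[of l] by fastforce
  then have "\<forall>\<^sub>F n in sequentially. q < a T (w n)"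
    using order_tendstoD(1)[OF l] q(1) by simp
  then obtain n where n: "q < a T (w n)" by (auto simp: eventually_sequentially)
  define b where "b = w n"
  have b: "q < a T b" "b < yT" using n unfolding b_def w_def by auto
  \<comment> \<open>By monotonicity \<open>a T x\<close> stays to the right of \<open>q\<close>, where a step to the left raises the energy.\<close>
  have fixed: "a T x = x" if x: "b \<le> x" "x \<le> yT" for x
  proof (rule ccontr)
    assume "a T x \<noteq> x"
    then have less: "a T x < x" using retreat[of x] by simp
    have "q < a T x" using b(1) monoD[OF minimiser_selection_mono[OF \<open>\<gamma> > 0\<close> sel] x(1)] by (rule less_le_trans)
    then have "tilted x < tilted (a T x)" using q(2) less x by simp
    moreover have "0 \<le> \<gamma> / 2 * (a T x - x)\<^sup>2" using \<open>\<gamma> > 0\<close> by simp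
    ultimately show False using min[of x x] by simp
  qed
  have close: "\<bar>tilted x - tilted y\<bar> \<le> \<gamma> / 2 * (x - y)\<^sup>2" if "b \<le> x" "x \<le> yT" "b \<le> y" "y \<le> yT" for x y
    using min[of x y] min[of y x] fixed[of x] fixed[of y] that
    unfolding abs_le_iff by (simp add: power2_commute)
  have "DERIV tilted x :> 0" if x: "b < x" "x < yT" for x
    unfolding DERIV_def
  proof (rule Lim_null_comparison)
    have "\<forall>\<^sub>F h in at 0. h \<in> {b - x<..<yT - x}" using x by (intro eventually_at_in_open') auto
    then show "\<forall>\<^sub>F h in at 0. norm ((tilted (x + h) - tilted x) / h) \<le> \<gamma> / 2 * \<bar>h\<bar>"
    proof eventually_elim
      case (elim h)
      then show ?case using close[of "x + h" x] x
        by (cases "h = 0") (auto simp: abs_divide field_simps power2_eq_square abs_mult_self_eq)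
    qed
    show "((\<lambda>h. \<gamma> / 2 * \<bar>h\<bar>) \<longlongrightarrow> 0) (at 0)"
      by (rule tendsto_eq_intros refl | simp)+
  qed
  then have "tilted yT = tilted b" by (intro DERIV_isconst_end b tilted_cont) auto
  moreover have "q \<le> b" using b(1) retreat[of b] by simp
  ultimately show False using q(2)[of b yT] b by simp
qed

end

theorem proposition5p4:
  fixes W :: "real \<Rightarrow> real" and a :: "real \<Rightarrow> real \<Rightarrow> real" and T \<gamma> yT :: real
  assumes periodic: "\<And>x. W (x + 1) = W x"
    and even: "\<And>x. W (- x) = W x"
    and lipschitz: "\<exists>L. L-lipschitz_on UNIV W"
    and sup_norm: "esssup lebesgue (\<lambda>x. ereal \<bar>deriv W x\<bar>) = 1"
    and zero_average: "integral {0..1} W = 0"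
    and unique_max: "\<exists>!x. x \<in> {0<..<1/2} \<and> local_maximum_on (diff_points W) (deriv W) x"
    and T: "0 < T" "T < 1"
    and yT: "yT \<in> {-1/2<..<0}"
    and yT_min: "local_minimum_on UNIV (\<lambda>y. T * y + W y) yT"
    and yT_unique: "\<And>y. y \<in> {-1/2..1/2} \<Longrightarrow> local_minimum_on UNIV (\<lambda>y. T * y + W y) y \<Longrightarrow> y = yT"
    and \<gamma>: "\<gamma> > 0"
    and selection: "minimiser_selection W \<gamma> a"
  shows "T < pinning_threshold a \<longleftrightarrow>
    (\<forall>y. is_arg_min (\<lambda>y. T * y + W y + \<gamma> / 2 * (y - yT)\<^sup>2) (\<lambda>_. True) y \<longleftrightarrow> y = yT)"
proof -
  obtain L where lip: "L-lipschitz_on UNIV W" using lipschitz by blast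
  interpret tilted_potential W T yT
  proof
    fix y assume y: "local_minimum_on UNIV (\<lambda>y. T * y + W y) y"
    define k where "k = \<lfloor>y + 1/2\<rfloor>"
    have "local_minimum_on UNIV (\<lambda>y. T * y + W y) (y - of_int k)"
    proof -
      have ev: "\<forall>\<^sub>F x in at y. T * y + W y \<le> T * x + W x"
        using y by (simp add: local_minimum_on_def)
      have "\<forall>\<^sub>F x in at (y - of_int k). T * y + W y \<le> T * (x + of_int k) + W (x + of_int k)"
        using ev unfolding eventually_at_to_0[of _ y] eventually_at_to_0[of _ "y - of_int k"]
        by (simp add: algebra_simps)
      then show ?thesis
        using periodic_int[of W, OF periodic] periodic_int[of W "y - of_int k" k, OF periodic]
        by (simp add: local_minimum_on_def algebra_simps)
    qed
    moreover have "y - of_int k \<in> {-1/2..1/2}" unfolding k_def by (simp, linarith)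
    ultimately have "y = yT + of_int k" using yT_unique by fastforce
    then show "\<exists>k. y = yT + of_int k" by blast
  qed (use periodic lipschitz_on_continuous_on[OF lip] T yT_min in auto)
  have argmin: "(\<forall>y. is_arg_min (\<lambda>y. T * y + W y + \<gamma> / 2 * (y - yT)\<^sup>2) (\<lambda>_. True) y \<longleftrightarrow> y = yT)
      \<longleftrightarrow> (\<forall>y. y \<noteq> yT \<longrightarrow> tilted yT < tilted y + \<gamma> / 2 * (y - yT)\<^sup>2)" (is "?unique \<longleftrightarrow> ?strict")
  proof
    assume u: ?unique
    show ?strict
    proof (intro allI impI, rule ccontr)
      fix y assume "y \<noteq> yT" and "\<not> tilted yT < tilted y + \<gamma> / 2 * (y - yT)\<^sup>2"
      moreover have "is_arg_min (\<lambda>y. T * y + W y + \<gamma> / 2 * (y - yT)\<^sup>2) (\<lambda>_. True) yT"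
        using u by blast
      ultimately have "is_arg_min (\<lambda>y. T * y + W y + \<gamma> / 2 * (y - yT)\<^sup>2) (\<lambda>_. True) y"
        unfolding is_arg_min_def tilted_def by (auto simp: not_less intro: order_trans)
      then show False using u \<open>y \<noteq> yT\<close> by blast
    qed
  next
    assume s: ?strict
    show ?unique
    proof (intro allI iffI)
      fix y assume "is_arg_min (\<lambda>y. T * y + W y + \<gamma> / 2 * (y - yT)\<^sup>2) (\<lambda>_. True) y"
      then have "tilted y + \<gamma> / 2 * (y - yT)\<^sup>2 \<le> tilted yT"
        unfolding is_arg_min_def tilted_def by (auto simp: not_less dest: spec[of _ yT])
      then show "y = yT" using s by force
    next
      fix y assume "y = yT"
      then show "is_arg_min (\<lambda>y. T * y + W y + \<gamma> / 2 * (y - yT)\<^sup>2) (\<lambda>_. True) y"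
        using s unfolding is_arg_min_def tilted_def by (metis add.right_neutral diff_self less_asym
          less_irrefl mult_zero_right power_zero_numeral)
    qed
  qed
  show ?thesis
    unfolding argmin
  proof
    assume "T < pinning_threshold a"
    then obtain T' p where "T < T'" "left_barrier W \<gamma> T' p"
      using less_pinning_threshold_iff[of W, OF periodic lip \<gamma> selection] T by auto
    then show ?strict using barrier_imp_strict_minimum[OF \<gamma>] by blast
  next
    assume ?strict
    then obtain w where "w < a T w" using strict_minimum_imp_advance[OF \<gamma> selection] by blast
    then have "T < T + \<gamma> * (a T w - w)" using \<gamma> by simp
    then show "T < pinning_threshold a"
      using less_pinning_threshold_iff[of W, OF periodic lip \<gamma> selection] T
        left_barrier_step[OF selection] less_imp_le by blast
  qed
qed

end
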